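(* Let $K=\mathrm{GF}(2^m)$ with $m\ge3$, let $d=2^i+1$ with $\gcd(i,m)=1$, let $n>1$, and let $A=K[x_1,\dots,x_n]$. Then any $4$ distinct powerpoints of $A_d$ are independent, i.e. if $\langle f_1^d\rangle,\dots,\langle f_4^d\rangle$ are pairwise distinct powerpoints then $f_1^d,\dots,f_4^d$ are linearly independent.
   Context: $A_m$ is the space of homogeneous polynomials of degree $m$ in $A$ (here $A_d$ for the degree $d$). A powerpoint of $A_d$ is a $1$-space $\langle f^d\rangle$ with $0\ne f\in A_1$. *)

theory Defs
  imports Complex_Main "HOL-Library.Poly_Mapping" "HOL-Library.Cardinality"
begin

text \<open>
  The polynomial ring \<open>K[x\<^sub>1, \<dots>, x\<^sub>n]\<close>: polynomials are finitely supported functions from monomials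
  to coefficients, and monomials are exponent vectors indexed by a finite type with
  \<open>n = CARD('n)\<close> elements.  The ring operations are those of the theory \<open>Poly_Mapping\<close>.
\<close>

type_synonym ('n, 'k) mpoly = "('n \<Rightarrow>\<^sub>0 nat) \<Rightarrow>\<^sub>0 'k"

definition monomial_degree :: "('n::finite \<Rightarrow>\<^sub>0 nat) \<Rightarrow> nat" where
  "monomial_degree t = (\<Sum>j\<in>UNIV. Poly_Mapping.lookup t j)"

text \<open>The space \<open>A\<^sub>e\<close>; it contains the zero polynomial.\<close>

definition homogeneous_polys :: "nat \<Rightarrow> ('n::finite, 'k::zero) mpoly set" where
  "homogeneous_polys e = {p. \<forall>t\<in>Poly_Mapping.keys p. monomial_degree t = e}"

definition mpoly_scale :: "'k::field \<Rightarrow> ('n::finite, 'k) mpoly \<Rightarrow> ('n, 'k) mpoly" where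
  "mpoly_scale c p = Poly_Mapping.map ((*) c) p"

global_interpretation mpoly: vector_space mpoly_scale
  by standard
    (simp_all add: mpoly_scale_def mult_map_scale_conv_mult algebra_simps single_add
      mult_single flip: mult.assoc)

text \<open>
  The 1-space \<open>\<langle>f\<^sup>d\<rangle>\<close>; it is a powerpoint of \<open>A\<^sub>d\<close> when \<open>f\<close> is a nonzero element of \<open>A\<^sub>1\<close>.
\<close>

definition powerpoint :: "nat \<Rightarrow> ('n::finite, 'k::field) mpoly \<Rightarrow> ('n, 'k) mpoly set" where
  "powerpoint d f = mpoly.span {f ^ d}"

end

theory Submission
  imports Defs "HOL-Computational_Algebra.Primes"
begin

text \<open>
  Let \<open>q = 2\<^sup>i\<close>.  If \<open>a\<close> is the coefficient vector of a linear form \<open>f\<close>, then \<open>f\<^sup>d = f\<^sup>q f\<close> has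
  coefficient \<open>a\<^sub>s\<^sup>q a\<^sub>t\<close> at \<open>x\<^sub>s\<^sup>q x\<^sub>t\<close>, so a relation \<open>\<Sum>\<^sub>j c\<^sub>j f\<^sub>j\<^sup>d = 0\<close> says that
  \<open>\<Sum>\<^sub>j c\<^sub>j \<phi>(a\<^sub>j) \<otimes> a\<^sub>j = 0\<close>, where \<open>\<phi>\<close> is the field automorphism \<open>x \<mapsto> x\<^sup>q\<close>, whose fixed field is
  \<open>GF(2)\<close> because \<open>gcd i m = 1\<close>.  Wedging the first factor with \<open>\<phi>(a\<^sub>2)\<close> and the second with
  \<open>a\<^sub>1\<close> leaves \<open>c\<^sub>3 \<phi>[23] \<otimes> [13] + c\<^sub>4 \<phi>[24] \<otimes> [14] = 0\<close> with \<open>[jk] = a\<^sub>j \<and> a\<^sub>k\<close>, and the same holds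
  with 1 and 2 exchanged.  If \<open>c\<^sub>3 \<noteq> 0\<close>, then \<open>[13] = l [14]\<close> and \<open>[23] = k [24]\<close> with
  \<open>k \<phi>(l) = l \<phi>(k)\<close>, hence \<open>k = l\<close>.  So \<open>a\<^sub>3 - l a\<^sub>4\<close>, which is nonzero, is proportional to both
  \<open>a\<^sub>1\<close> and \<open>a\<^sub>2\<close>, a contradiction.
\<close>

subsection \<open>The relation between rank one tensors\<close>

definition minor :: "('a \<Rightarrow> 'k::comm_ring) \<Rightarrow> ('a \<Rightarrow> 'k) \<Rightarrow> 'a \<Rightarrow> 'a \<Rightarrow> 'k" where
  "minor p r s t = p s * r t - p t * r s"

definition parallel :: "('a \<Rightarrow> 'k::comm_ring) \<Rightarrow> ('a \<Rightarrow> 'k) \<Rightarrow> bool" where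
  "parallel p r \<longleftrightarrow> (\<forall>s t. minor p r s t = 0)"

lemma parallel_commute: "parallel p r \<longleftrightarrow> parallel r p"
  by (auto simp: parallel_def minor_def algebra_simps)

lemma parallel_imp_scaled:
  fixes p r :: "'a \<Rightarrow> 'k::field"
  assumes "parallel p r" and "r s \<noteq> 0"
  shows "p t = p s / r s * r t"
  using assms by (auto simp: parallel_def minor_def field_simps)

text \<open>The zero vector is parallel to every vector, so the middle vector must be
  nonzero.\<close>

lemma parallel_trans:
  fixes p r u :: "'a \<Rightarrow> 'k::field"
  assumes "parallel p r" and "parallel r u" and "r s \<noteq> 0"
  shows "parallel p u"
proof -
  obtain b where p: "p t = b * r t" for t
    using parallel_imp_scaled[OF assms(1,3)] by blast
  obtain c where u: "u t = c * r t" for t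
    using parallel_imp_scaled[OF parallel_commute[THEN iffD1, OF assms(2)] assms(3)] by blast
  show ?thesis
    by (simp add: parallel_def minor_def p u)
qed

lemma wedge_relation:
  fixes a1 a2 a3 a4 :: "'a \<Rightarrow> 'k::field"
  assumes diff: "\<And>x y :: 'k. (x - y) ^ q = x ^ q - y ^ q"
    and rel: "\<And>s t. c1 * a1 s ^ q * a1 t + c2 * a2 s ^ q * a2 t
               + c3 * a3 s ^ q * a3 t + c4 * a4 s ^ q * a4 t = 0"
  shows "c3 * minor a2 a3 s s' ^ q * minor a1 a3 t t'
       + c4 * minor a2 a4 s s' ^ q * minor a1 a4 t t' = 0"
proof -
  let ?R = "\<lambda>s t. c1 * a1 s ^ q * a1 t + c2 * a2 s ^ q * a2 t
               + c3 * a3 s ^ q * a3 t + c4 * a4 s ^ q * a4 t"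
  \<comment> \<open>Antisymmetrizing \<open>?R\<close> against the \<open>q\<close>-th power of
    \<open>a2\<close> in the first index and against \<open>a1\<close> in the second cancels the
    \<open>c2\<close> and \<open>c1\<close> terms; \<open>diff\<close> moves the power inside the
    minors.\<close>
  have "c3 * minor a2 a3 s s' ^ q * minor a1 a3 t t'
       + c4 * minor a2 a4 s s' ^ q * minor a1 a4 t t'
      = a2 s ^ q * (a1 t * ?R s' t' - a1 t' * ?R s' t)
        - a2 s' ^ q * (a1 t * ?R s t' - a1 t' * ?R s t)"
    unfolding minor_def diff power_mult_distrib by algebra
  then show ?thesis
    by (simp only: rel) simp
qed

lemma tensor_coefficient_eq_0:
  fixes a1 a2 a3 a4 :: "'a \<Rightarrow> 'k::field"
  assumes diff: "\<And>x y :: 'k. (x - y) ^ q = x ^ q - y ^ q"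
    and fixed: "\<And>x :: 'k. x ^ q = x \<Longrightarrow> x = 0 \<or> x = 1"
    and np: "\<not> parallel a1 a2" "\<not> parallel a1 a3" "\<not> parallel a2 a3" "\<not> parallel a3 a4"
    and rel: "\<And>s t. c1 * a1 s ^ q * a1 t + c2 * a2 s ^ q * a2 t
               + c3 * a3 s ^ q * a3 t + c4 * a4 s ^ q * a4 t = 0"
  shows "c3 = 0"
proof (rule ccontr)
  assume "c3 \<noteq> 0"
  have E1: "c3 * minor a2 a3 s s' ^ q * minor a1 a3 t t'
       + c4 * minor a2 a4 s s' ^ q * minor a1 a4 t t' = 0" for s s' t t'
    by (rule wedge_relation[OF diff rel])
  have E2: "c3 * minor a1 a3 s s' ^ q * minor a2 a3 t t'
       + c4 * minor a1 a4 s s' ^ q * minor a2 a4 t t' = 0" for s s' t t'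
    by (rule wedge_relation[OF diff, of c2 _ c1]) (use rel in \<open>simp add: add_ac\<close>)
  obtain s s' where s: "minor a2 a3 s s' \<noteq> 0"
    using np unfolding parallel_def by blast
  obtain t t' where t: "minor a1 a3 t t' \<noteq> 0"
    using np unfolding parallel_def by blast
  \<comment> \<open>\<open>l\<close> and \<open>k\<close> solve \<open>E1\<close> and
    \<open>E2\<close> at one fixed nonzero minor, so a single scalar serves all the other index
    pairs.\<close>
  define l where "l = - (c4 * minor a2 a4 s s' ^ q) / (c3 * minor a2 a3 s s' ^ q)"
  define k where "k = - (c4 * minor a1 a4 t t' ^ q) / (c3 * minor a1 a3 t t' ^ q)"
  have l: "minor a1 a3 x y = l * minor a1 a4 x y" for x y
    using E1[of s s' x y] s \<open>c3 \<noteq> 0\<close> by (simp add: l_def field_simps eq_neg_iff_add_eq_0)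
  have k: "minor a2 a3 x y = k * minor a2 a4 x y" for x y
    using E2[of t t' x y] t \<open>c3 \<noteq> 0\<close> by (simp add: k_def field_simps eq_neg_iff_add_eq_0)
  have nz: "l \<noteq> 0" "k \<noteq> 0" "minor a1 a4 t t' \<noteq> 0" "minor a2 a4 s s' \<noteq> 0"
    using s t l k by auto
  \<comment> \<open>Inserting the proportionality by \<open>k\<close> into the definition of
    \<open>l\<close> cancels the minors there, and vice versa below.\<close>
  have "l * k ^ q * c3 = - c4"
    using nz \<open>c3 \<noteq> 0\<close> by (simp add: l_def k[of s s'] power_mult_distrib)
  moreover have "k * l ^ q * c3 = - c4"
    using nz \<open>c3 \<noteq> 0\<close> by (simp add: k_def l[of t t'] power_mult_distrib)
  ultimately have "l * k ^ q = k * l ^ q"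
    using \<open>c3 \<noteq> 0\<close> by (metis mult_cancel_right)
  then have "(k / l) ^ q = k / l"
    using nz by (simp add: power_divide field_simps)
  then have "k = l"
    using fixed[of "k / l"] nz by simp
  define w where "w x = a3 x - l * a4 x" for x
  have "parallel a1 w" "parallel w a2"
    using l k \<open>k = l\<close> by (auto simp: parallel_def minor_def w_def algebra_simps)
  moreover have "\<exists>x. w x \<noteq> 0"
  proof (rule ccontr)
    assume "\<nexists>x. w x \<noteq> 0"
    then have "a3 x = l * a4 x" for x
      by (simp add: w_def)
    then show False
      using np(4) by (simp add: parallel_def minor_def)
  qed
  then obtain x where "w x \<noteq> 0" ..
  ultimately have "parallel a1 a2"
    by (rule parallel_trans)
  with np show False by blast
qed

text \<open>The relation is symmetric in the four vectors, so each of them can be moved to the third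
  place of \<open>tensor_coefficient_eq_0\<close>.\<close>

lemma tensor_coefficients_eq_0:
  fixes a :: "nat \<Rightarrow> 'a \<Rightarrow> 'k::field"
  assumes diff: "\<And>x y :: 'k. (x - y) ^ q = x ^ q - y ^ q"
    and fixed: "\<And>x :: 'k. x ^ q = x \<Longrightarrow> x = 0 \<or> x = 1"
    and np: "\<And>j k. j \<in> {1..4} \<Longrightarrow> k \<in> {1..4} \<Longrightarrow> j \<noteq> k \<Longrightarrow> \<not> parallel (a j) (a k)"
    and rel: "\<And>s t. (\<Sum>j\<in>{1..4}. c j * a j s ^ q * a j t) = 0"
    and "j \<in> {1..4}"
  shows "c j = 0"
proof -
  have set4: "{1..4::nat} = {1, 2, 3, 4}"
    by auto
  have rel4: "c 1 * a 1 s ^ q * a 1 t + c 2 * a 2 s ^ q * a 2 t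
      + c 3 * a 3 s ^ q * a 3 t + c 4 * a 4 s ^ q * a 4 t = 0" for s t
    using rel[of s t] unfolding set4 by (simp add: add_ac)
  note * = tensor_coefficient_eq_0[OF diff fixed]
  have "c 3 = 0"
    by (rule *[of "a 1" "a 2" "a 3" "a 4" "c 1" "c 2" _ "c 4"])
      (use rel4 in \<open>auto simp: add_ac np simp del: One_nat_def\<close>)
  moreover have "c 4 = 0"
    by (rule *[of "a 1" "a 2" "a 4" "a 3" "c 1" "c 2" _ "c 3"])
      (use rel4 in \<open>auto simp: add_ac np simp del: One_nat_def\<close>)
  moreover have "c 1 = 0"
    by (rule *[of "a 3" "a 4" "a 1" "a 2" "c 3" "c 4" _ "c 2"])
      (use rel4 in \<open>auto simp: add_ac np simp del: One_nat_def\<close>)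
  moreover have "c 2 = 0"
    by (rule *[of "a 3" "a 4" "a 2" "a 1" "c 3" "c 4" _ "c 1"])
      (use rel4 in \<open>auto simp: add_ac np simp del: One_nat_def\<close>)
  ultimately show ?thesis
    using \<open>j \<in> {1..4}\<close> unfolding set4 by auto
qed

subsection \<open>Finite fields of characteristic two\<close>

text \<open>
  The library has this only for the class \<open>finite_field\<close>, of which \<open>{field, finite}\<close> is not a
  subclass.
\<close>

lemma power_CARD_eq_same: "x ^ CARD('k) = (x :: 'k::{field,finite})"
proof (cases "x = 0")
  case False
  have "bij_betw ((*) x) (UNIV - {0}) (UNIV - {0})"
    by (rule bij_betw_byWitness[where f' = "\<lambda>y. y / x"]) (use False in auto)
  then have "(\<Prod>y\<in>UNIV - {0}. x * y) = \<Prod>(UNIV - {0})"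
    using prod.reindex_bij_betw[of "(*) x" _ _ "\<lambda>y. y"] by blast
  then have "x ^ card (UNIV - {0 :: 'k}) = 1"
    by (simp add: prod.distrib)
  then show ?thesis
    by (metis UNIV_I card_Suc_Diff1 finite mult.right_neutral power_Suc)
qed (simp add: zero_power)

text \<open>At -1 the identity \<open>x ^ CARD('k) = x\<close> has an even exponent, which forces -1
  = 1.\<close>

lemma CHAR_eq_2:
  assumes "CARD('k::{field,finite}) = 2 ^ m"
  shows "CHAR('k) = 2"
proof -
  have "m \<noteq> 0"
  proof
    assume "m = 0"
    then have "is_singleton (UNIV :: 'k set)"
      using assms by (simp add: is_singleton_altdef)
    then show False
      by (metis UNIV_I is_singletonE singletonD zero_neq_one)
  qed
  then have "(-1 :: 'k) = 1"
    using power_CARD_eq_same[of "-1 :: 'k"] assms by simp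
  then have "of_nat 2 = (0 :: 'k)"
    by (metis add.right_inverse of_nat_numeral one_add_one)
  then have "CHAR('k) dvd 2"
    by (simp only: of_nat_eq_0_iff_char_dvd)
  then show ?thesis
    by (metis CHAR_not_1' One_nat_def prime_nat_iff two_is_prime_nat)
qed

text \<open>The \<open>e\<close> with \<open>x ^ 2 ^ e = x\<close> are closed under multiples. By
  Bezout a multiple of \<open>i\<close> exceeds a multiple of \<open>m\<close> by one, so squaring
  fixes \<open>x\<close>.\<close>

lemma fixed_by_coprime_powers_of_2:
  fixes x :: "'a::field"
  assumes "x ^ 2 ^ i = x" and "x ^ 2 ^ m = x" and "gcd i m = 1" and "i \<noteq> 0"
  shows "x = 0 \<or> x = 1"
proof -
  have iter: "x ^ 2 ^ (e * b) = x" if "x ^ 2 ^ e = x" for e b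
    by (induction b) (simp_all add: that power_add power_mult)
  obtain a b where ab: "i * a = m * b + 1"
    using bezout_nat[OF \<open>i \<noteq> 0\<close>, of m] assms(3) by auto
  have "x = x ^ 2 ^ (i * a)"
    by (simp add: iter assms)
  also have "\<dots> = (x ^ 2 ^ (m * b)) ^ 2"
    by (metis ab power_add power_mult power_one_right)
  also have "\<dots> = x ^ 2"
    by (simp add: iter assms)
  finally show ?thesis
    by (simp add: power2_eq_square)
qed

text \<open>Makes the freshman's dream available for polynomials; \<open>of_nat n\<close> is a
  constant, read off at the monomial 0.\<close>

lemma CHAR_poly_mapping:
  "CHAR('a::comm_monoid_add \<Rightarrow>\<^sub>0 'k::comm_ring_1) = CHAR('k)"
proof (rule CHAR_eqI)
  show "of_nat CHAR('k) = (0 :: 'a \<Rightarrow>\<^sub>0 'k)"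
    by (rule poly_mapping_eqI) (simp add: lookup_of_nat)
next
  fix n
  assume "of_nat n = (0 :: 'a \<Rightarrow>\<^sub>0 'k)"
  then have "Poly_Mapping.lookup (of_nat n :: 'a \<Rightarrow>\<^sub>0 'k) 0 = 0"
    by (simp only: lookup_zero)
  then show "CHAR('k) dvd n"
    by (simp add: lookup_of_nat of_nat_eq_0_iff_char_dvd)
qed

subsection \<open>Powers of linear forms\<close>

abbreviation linear_coeff :: "('n, 'k::zero) mpoly \<Rightarrow> 'n \<Rightarrow> 'k" where
  "linear_coeff f s \<equiv> Poly_Mapping.lookup f (Poly_Mapping.single s 1)"

lemma lookup_mpoly_scale: "Poly_Mapping.lookup (mpoly_scale c p) t = c * Poly_Mapping.lookup p t"
  by (simp add: mpoly_scale_def Poly_Mapping.map.rep_eq when_def)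

lemma mpoly_scale_conv_mult: "mpoly_scale c p = Poly_Mapping.single 0 c * p"
  by (simp add: mpoly_scale_def mult_map_scale_conv_mult)

lemma single_power:
  "Poly_Mapping.single t c ^ e = Poly_Mapping.single (Poly_Mapping.map ((*) e) t) (c ^ e)"
  for t :: "'n \<Rightarrow>\<^sub>0 nat" and c :: "'k::comm_ring_1"
proof -
  have "Poly_Mapping.map ((*) (Suc e)) t = t + Poly_Mapping.map ((*) e) t" for e
    by (rule poly_mapping_eqI) (simp add: lookup_add Poly_Mapping.map.rep_eq when_def)
  moreover have "Poly_Mapping.map ((*) 0) t = 0"
    by (rule poly_mapping_eqI) (simp add: Poly_Mapping.map.rep_eq when_def)
  ultimately show ?thesis
    by (induction e) (simp_all add: mult_single)
qed

lemma mpoly_scale_power: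
  fixes p :: "('n::finite, 'k::field) mpoly"
  shows "mpoly_scale c p ^ e = mpoly_scale (c ^ e) (p ^ e)"
proof -
  have "Poly_Mapping.map ((*) e) (0 :: 'n \<Rightarrow>\<^sub>0 nat) = 0"
    by (rule poly_mapping_eqI) (simp add: Poly_Mapping.map.rep_eq)
  then show ?thesis
    by (simp add: mpoly_scale_conv_mult power_mult_distrib single_power)
qed

lemma monomial_degree_eq_1E:
  assumes "monomial_degree t = 1"
  obtains s where "t = Poly_Mapping.single s 1"
proof -
  obtain s where "Poly_Mapping.lookup t s = 1" "\<And>j. j \<noteq> s \<Longrightarrow> Poly_Mapping.lookup t j = 0"
    using assms unfolding monomial_degree_def by (metis finite UNIV_I sum_eq_1_iff)
  then have "t = Poly_Mapping.single s 1"
    by (intro poly_mapping_eqI) (auto simp: lookup_single when_def)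
  then show ?thesis by (rule that)
qed

text \<open>The monomials of degree one are exactly the variables, and all other coefficients of a
  linear form vanish.\<close>

lemma linear_form_eqI:
  assumes "f \<in> homogeneous_polys 1" and "g \<in> homogeneous_polys 1"
    and "\<And>s. linear_coeff f s = linear_coeff g s"
  shows "f = g"
proof (rule poly_mapping_eqI)
  fix t
  show "Poly_Mapping.lookup f t = Poly_Mapping.lookup g t"
  proof (cases "monomial_degree t = 1")
    case True
    then show ?thesis using assms(3) by (metis monomial_degree_eq_1E)
  next
    case False
    then show ?thesis
      using assms(1,2) unfolding homogeneous_polys_def
      by (metis (mono_tags, lifting) in_keys_iff mem_Collect_eq)
  qed
qed

lemma monomial_degree_single: "monomial_degree (Poly_Mapping.single s e) = e"
  by (simp add: monomial_degree_def lookup_single when_def)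

lemma single_1_eq_iff:
  "Poly_Mapping.single s (1 :: nat) = Poly_Mapping.single t 1 \<longleftrightarrow> s = t"
  by (metis keys_single singleton_inject zero_neq_one)

lemma linear_form_eq_sum:
  fixes f :: "('n::finite, 'k::comm_ring_1) mpoly"
  assumes "f \<in> homogeneous_polys 1"
  shows "f = (\<Sum>s\<in>UNIV. Poly_Mapping.single (Poly_Mapping.single s 1) (linear_coeff f s))"
    (is "_ = ?g")
proof (rule linear_form_eqI[OF assms])
  have *: "Poly_Mapping.lookup ?g t
      = (\<Sum>s\<in>UNIV. linear_coeff f s when Poly_Mapping.single s 1 = t)" for t
    by (simp add: lookup_sum lookup_single)
  show "?g \<in> homogeneous_polys 1"
    unfolding homogeneous_polys_def
  proof safe
    fix t
    assume "t \<in> Poly_Mapping.keys ?g"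
    then have "\<exists>s. Poly_Mapping.single s 1 = t"
      unfolding in_keys_iff * by (metis (mono_tags, lifting) sum.neutral when_def)
    then show "monomial_degree t = 1"
      by (auto simp: monomial_degree_single)
  qed
  show "linear_coeff f s = linear_coeff ?g s" for s
    unfolding * by (simp add: when_def single_1_eq_iff del: One_nat_def)
qed

text \<open>For \<open>q \<ge> 2\<close> only the variable \<open>s\<close> has an exponent reaching
  \<open>q\<close>; for \<open>q = 1\<close> swapping \<open>s\<close> and \<open>t\<close> would
  give the same monomial.\<close>

lemma monomial_eq_iff:
  assumes "q \<ge> 2"
  shows "Poly_Mapping.single s q + Poly_Mapping.single t 1
      = Poly_Mapping.single s' q + Poly_Mapping.single t' (1::nat) \<longleftrightarrow> s = s' \<and> t = t'"
proof
  assume eq: "Poly_Mapping.single s q + Poly_Mapping.single t 1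
      = Poly_Mapping.single s' q + Poly_Mapping.single t' (1::nat)"
  have *: "(q when s = j) + (1 when t = j) = (q when s' = j) + (1 when t' = j)" for j
    using arg_cong[OF eq, of "\<lambda>p. Poly_Mapping.lookup p j"] by (simp add: lookup_add lookup_single)
  have "s = s'"
    using *[of s] assms by (auto simp: when_def split: if_splits)
  moreover have "t = t'"
    using *[of t] \<open>s = s'\<close> by (auto simp: when_def split: if_splits)
  ultimately show "s = s' \<and> t = t'" ..
qed auto

text \<open>Frobenius expands \<open>f ^ q\<close> without cross terms, and multiplying by
  \<open>f\<close> then yields distinct monomials for distinct pairs, so no terms are
  collected.\<close>

lemma lookup_linear_form_power:
  fixes f :: "('n::finite, 'k::comm_ring_1) mpoly"
  assumes "f \<in> homogeneous_polys 1" and "prime CHAR('k)" and "q = CHAR('k) ^ i" and "q \<ge> 2"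
  shows "Poly_Mapping.lookup (f ^ (q + 1)) (Poly_Mapping.single s q + Poly_Mapping.single t 1)
       = linear_coeff f s ^ q * linear_coeff f t"
proof -
  let ?X = "\<lambda>s. Poly_Mapping.single s 1 :: 'n \<Rightarrow>\<^sub>0 nat"
  define a where "a = linear_coeff f"
  have f: "f = (\<Sum>s\<in>UNIV. Poly_Mapping.single (?X s) (a s))"
    using linear_form_eq_sum[OF assms(1)] by (simp add: a_def)
  have "f ^ q = (\<Sum>s\<in>UNIV. Poly_Mapping.single (?X s) (a s) ^ q)"
    by (subst f, rule freshmans_dream_sum') (use assms in \<open>simp_all add: CHAR_poly_mapping\<close>)
  also have "\<dots> = (\<Sum>s\<in>UNIV. Poly_Mapping.single (Poly_Mapping.single s q) (a s ^ q))"
    by (simp add: single_power)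
  finally have "f ^ (q + 1) = \<dots> * (\<Sum>t\<in>UNIV. Poly_Mapping.single (?X t) (a t))"
    using f by simp
  also have "\<dots> = (\<Sum>s\<in>UNIV. \<Sum>t\<in>UNIV.
      Poly_Mapping.single (Poly_Mapping.single s q + ?X t) (a s ^ q * a t))"
    by (simp add: sum_product mult_single)
  also have "Poly_Mapping.lookup \<dots> (Poly_Mapping.single s q + ?X t)
      = (\<Sum>s'\<in>UNIV. \<Sum>t'\<in>UNIV. a s' ^ q * a t' when s' = s \<and> t' = t)"
    by (simp only: lookup_sum lookup_single monomial_eq_iff[OF \<open>q \<ge> 2\<close>])
  \<comment> \<open>The conjunction becomes nested conditions so that the two sums collapse one
    after the other.\<close>
  also have "\<dots> = (\<Sum>s'\<in>UNIV. \<Sum>t'\<in>UNIV. if t' = t then a s' ^ q * a t' when s' = s else 0)"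
    by (intro sum.cong) (auto simp: when_def)
  also have "\<dots> = a s ^ q * a t"
    by (simp add: when_def)
  finally show ?thesis by (simp add: a_def)
qed

text \<open>Proportional forms have proportional powers. The contrapositive turns distinct
  powerpoints into non-parallel coefficient vectors.\<close>

lemma powerpoint_eq_if_parallel:
  fixes f g :: "('n::finite, 'k::field) mpoly"
  assumes f: "f \<in> homogeneous_polys 1" "f \<noteq> 0" and g: "g \<in> homogeneous_polys 1" "g \<noteq> 0"
    and par: "parallel (linear_coeff f) (linear_coeff g)"
  shows "powerpoint d f = powerpoint d g"
proof -
  have zero: "(0 :: ('n, 'k) mpoly) \<in> homogeneous_polys 1"
    by (simp add: homogeneous_polys_def)
  obtain s where s: "linear_coeff g s \<noteq> 0"
    using linear_form_eqI[OF g(1) zero] g(2) by auto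
  define c where "c = linear_coeff f s / linear_coeff g s"
  have "mpoly_scale c g \<in> homogeneous_polys 1"
    using g(1) by (auto simp: homogeneous_polys_def in_keys_iff lookup_mpoly_scale)
  then have fg: "f = mpoly_scale c g"
    by (rule linear_form_eqI[OF f(1)])
      (unfold lookup_mpoly_scale c_def, rule parallel_imp_scaled[OF par s])
  then have "c \<noteq> 0"
    using f(2) by auto
  \<comment> \<open>Since \<open>c ^ d\<close> is nonzero, its inverse recovers \<open>g ^ d\<close>
    from \<open>f ^ d\<close>.\<close>
  then show ?thesis
    unfolding powerpoint_def fg mpoly_scale_power
    by (intro mpoly.span_eq[THEN iffD2])
      (auto simp: mpoly.span_singleton intro: image_eqI[where x = "inverse (c ^ d)"])
qed

theorem theorem3p3:
  fixes f :: "nat \<Rightarrow> ('n::finite, 'k::{field,finite}) mpoly"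
    and m i d :: nat
  assumes "CARD('k) = 2 ^ m" and "m \<ge> 3"
    and "d = 2 ^ i + 1" and "gcd i m = 1"
    and "CARD('n) > 1"
    and "\<And>j. j \<in> {1..4} \<Longrightarrow> f j \<in> homogeneous_polys 1 \<and> f j \<noteq> 0"
    and "inj_on (\<lambda>j. powerpoint d (f j)) {1..4}"
  shows "inj_on (\<lambda>j. f j ^ d) {1..4} \<and> mpoly.independent ((\<lambda>j. f j ^ d) ` {1..4})"
proof
  define q :: nat where "q = 2 ^ i"
  \<comment> \<open>For \<open>i = 0\<close> the gcd would be \<open>m\<close>, which is at least
    3.\<close>
  have "i \<noteq> 0"
    using assms(2,4) by (intro notI) simp
  then have q: "q \<ge> 2"
    unfolding q_def by (cases i) simp_all
  have char: "CHAR('k) = 2"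
    by (rule CHAR_eq_2[OF assms(1)])
  \<comment> \<open>The additive rule is applied to \<open>x - y\<close> and \<open>y\<close>, whose
    sum is \<open>x\<close>.\<close>
  have diff: "(x - y) ^ q = x ^ q - y ^ q" for x y :: 'k
    using freshmans_dream'[of q i "x - y" y] char by (simp add: q_def algebra_simps)
  have fixed: "x = 0 \<or> x = 1" if "x ^ q = x" for x :: 'k
    using fixed_by_coprime_powers_of_2[of x i m] that assms(1,4) \<open>i \<noteq> 0\<close> power_CARD_eq_same[of x]
    by (simp add: q_def)
  have np: "\<not> parallel (linear_coeff (f j)) (linear_coeff (f k))"
    if "j \<in> {1..4}" "k \<in> {1..4}" "j \<noteq> k" for j k
    using powerpoint_eq_if_parallel[of "f j" "f k" d] assms(6)[OF that(1)] assms(6)[OF that(2)]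
      inj_onD[OF assms(7) _ that(1,2)] that(3) by blast
  show inj: "inj_on (\<lambda>j. f j ^ d) {1..4}"
    using assms(7) unfolding powerpoint_def inj_on_def by metis
  show "mpoly.independent ((\<lambda>j. f j ^ d) ` {1..4})"
  proof
    assume "mpoly.dependent ((\<lambda>j. f j ^ d) ` {1..4})"
    then obtain u where u: "\<exists>v\<in>(\<lambda>j. f j ^ d) ` {1..4}. u v \<noteq> 0"
      and sum: "(\<Sum>v\<in>(\<lambda>j. f j ^ d) ` {1..4}. mpoly_scale (u v) v) = 0"
      by (auto simp: mpoly.dependent_finite)
    \<comment> \<open>The weights \<open>u\<close> live on the set of powers; \<open>inj\<close>
      allows indexing them by \<open>j\<close>.\<close>
    define c where "c j = u (f j ^ d)" for j
    have sum': "(\<Sum>j\<in>{1..4}. mpoly_scale (c j) (f j ^ d)) = 0"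
      using sum unfolding sum.reindex[OF inj] by (simp add: c_def)
    have rel: "(\<Sum>j\<in>{1..4}. c j * linear_coeff (f j) s ^ q * linear_coeff (f j) t) = 0" for s t
    proof -
      \<comment> \<open>\<open>?x\<close> is the monomial whose coefficient in each power is a rank
        one product.\<close>
      let ?x = "Poly_Mapping.single s q + Poly_Mapping.single t 1"
      have "(\<Sum>j\<in>{1..4}. c j * linear_coeff (f j) s ^ q * linear_coeff (f j) t)
          = (\<Sum>j\<in>{1..4}. Poly_Mapping.lookup (mpoly_scale (c j) (f j ^ d)) ?x)"
      proof (rule sum.cong[OF refl])
        fix j :: nat
        assume "j \<in> {1..4}"
        then have "Poly_Mapping.lookup (f j ^ (q + 1)) ?x
            = linear_coeff (f j) s ^ q * linear_coeff (f j) t"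
          using assms(6) char q by (intro lookup_linear_form_power[where i = i]) (auto simp: q_def)
        then show "c j * linear_coeff (f j) s ^ q * linear_coeff (f j) t
            = Poly_Mapping.lookup (mpoly_scale (c j) (f j ^ d)) ?x"
          by (simp add: lookup_mpoly_scale assms(3) q_def mult.assoc)
      qed
      also have "\<dots> = Poly_Mapping.lookup (\<Sum>j\<in>{1..4}. mpoly_scale (c j) (f j ^ d)) ?x"
        by (simp add: lookup_sum)
      finally show ?thesis
        unfolding sum' by simp
    qed
    have "c j = 0" if "j \<in> {1..4}" for j
      using tensor_coefficients_eq_0[where a = "\<lambda>j. linear_coeff (f j)", OF diff fixed np rel that] .
    then show False
      using u by (auto simp: c_def)
  qed
qed

end
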